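(* Let $V=V(r,z)$ be a $C^1$ function on $(\mathbb{R}^2\setminus\{0\})\times\mathbb{R}$ such that, for some constant $c_2>0$, \begin{align*} &V(r,z)=0 &&\text{for all } z\le 0,\\ &|\nabla V(r,z)|\le |r| &&\text{for all } |r|>0 \text{ and } z\in\mathbb{R},\\ &r\cdot\nabla_r V(r,z)\ge c_2\big(\partial_z V(r,z)\big)^2 &&\text{for all } |r|>0\text{ and } z\in\mathbb{R}. \end{align*} If $V(r,z)=\psi_1(|r|)\,\psi_2(z)$ for suitable functions $\psi_1:(0,+\infty)\to\mathbb{R}$ and $\psi_2:\mathbb{R}\to\mathbb{R}$, then $V\equiv 0$.
   Context: Points of $\mathbb{R}^3$ are written $(r,z)$ with $r=(x_1,x_2)\in\mathbb{R}^2$ and $z=x_3\in\mathbb{R}$; $\nabla_r$ is the gradient with respect to $r$, and $\nabla$ is the full gradient with respect to $(r,z)$. *)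

theory Defs
  imports "HOL-Analysis.Analysis"
begin

definition gradient :: "('a::real_inner \<Rightarrow> real) \<Rightarrow> 'a \<Rightarrow> 'a" where
  "gradient f x = (THE D. GDERIV f x :> D)"

lemma gradient_eqI: "GDERIV f x :> D \<Longrightarrow> gradient f x = D"
proof -
  assume D: "GDERIV f x :> D"
  have "D' = D" if "GDERIV f x :> D'" for D'
  proof -
    have "(\<lambda>h. inner h D') = (\<lambda>h. inner h D)"
      using that D unfolding gderiv_def by (rule has_derivative_unique)
    then have "inner h D' = inner h D" for h
      by (rule fun_cong)
    then show ?thesis
      using vector_eq_ldot by blast
  qed
  with D show ?thesis
    unfolding gradient_def by (rule the_equality)
qed

text \<open>Intended for open \<open>S\<close>: the derivative at a point of \<open>S\<close> is taken in the whole space.\<close>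

definition C1_on :: "('a::euclidean_space \<Rightarrow> real) \<Rightarrow> 'a set \<Rightarrow> bool" where
  "C1_on f S \<longleftrightarrow> (\<forall>x\<in>S. f differentiable (at x)) \<and> continuous_on S (gradient f)"

end

(* Unless V vanishes, V(r,z) = psi_1(|r|) psi_2(z) makes the last hypothesis, at a fixed height z
   with psi_2'(z) nonzero, a Riccati inequality u' >= k u^2 with k > 0 for u(t) = V(e^t r, z).
   Since u is defined for all real t and solutions of the Riccati inequality blow up in finite
   time, forwards if positive and backwards if negative, u must vanish identically. *)

theory Submission
  imports Defs
begin

text \<open>A positive value persists forwards because \<open>g\<close> is nondecreasing. Then
  \<open>1/g\<close> falls at rate at least \<open>k\<close> and would have to reach zero in finite
  time.\<close>

lemma riccati_inequality_global_nonpos: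
  fixes g g' :: "real \<Rightarrow> real"
  assumes der: "\<And>t. (g has_real_derivative g' t) (at t)"
    and ric: "\<And>t. g' t \<ge> k * (g t)\<^sup>2" and k: "k > 0"
  shows "g a \<le> 0"
proof (rule ccontr)
  assume "\<not> g a \<le> 0"
  then have ga: "g a > 0" by simp
  have pos: "g t > 0" if "a \<le> t" for t
  proof -
    have "g a \<le> g t"
    proof (rule DERIV_nonneg_imp_nondecreasing[OF that])
      fix x
      have "0 \<le> k * (g x)\<^sup>2" using k by simp
      with ric[of x] der[of x] show "\<exists>y. (g has_real_derivative y) (at x) \<and> 0 \<le> y"
        by force
    qed
    with ga show ?thesis by simp
  qed
  \<comment> \<open>The latest possible blow-up time: a line of slope \<open>-k\<close> starting
    from \<open>1 / g a\<close> at \<open>a\<close> meets zero at \<open>b\<close>.\<close>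
  define b where "b = a + 1 / (k * g a)"
  have ab: "a \<le> b" unfolding b_def using k ga by simp
  have "inverse (g b) + k * b \<le> inverse (g a) + k * a"
  proof (rule DERIV_nonpos_imp_nonincreasing[OF ab])
    fix x assume "a \<le> x"
    then have gx: "g x > 0" by (rule pos)
    have "((\<lambda>t. inverse (g t) + k * t) has_real_derivative - (g' x / (g x)\<^sup>2) + k) (at x)"
      using gx by (auto intro!: derivative_eq_intros der simp: power2_eq_square field_simps)
    moreover have "k \<le> g' x / (g x)\<^sup>2"
      using ric[of x] gx by (simp add: pos_le_divide_eq)
    ultimately show "\<exists>y. ((\<lambda>t. inverse (g t) + k * t) has_real_derivative y) (at x) \<and> y \<le> 0"
      by force
  qed
  moreover have "k * b = k * a + inverse (g a)"
    unfolding b_def using k ga by (simp add: field_simps)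
  ultimately have "inverse (g b) \<le> 0" by simp
  with pos[OF ab] show False by simp
qed

text \<open>The reflection \<open>- g (- t)\<close> satisfies the same inequality, so the forward
  bound applied to it at \<open>- a\<close> excludes negative values.\<close>

lemma riccati_inequality_global_zero:
  fixes g g' :: "real \<Rightarrow> real"
  assumes der: "\<And>t. (g has_real_derivative g' t) (at t)"
    and ric: "\<And>t. g' t \<ge> k * (g t)\<^sup>2" and k: "k > 0"
  shows "g a = 0"
proof -
  have "g a \<le> 0" by (rule riccati_inequality_global_nonpos[OF der ric k])
  moreover have "- g (- (- a)) \<le> 0"
  proof (rule riccati_inequality_global_nonpos[where g = "\<lambda>t. - g (- t)" and g' = "\<lambda>t. g' (- t)"])
    show "((\<lambda>t. - g (- t)) has_real_derivative g' (- t)) (at t)" for t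
      by (auto intro!: derivative_eq_intros DERIV_chain2[OF der])
    show "k * (- g (- t))\<^sup>2 \<le> g' (- t)" for t using ric[of "- t"] by simp
  qed (rule k)
  ultimately show ?thesis by simp
qed

text \<open>Riesz representation, with the vector built from the values of the derivative on the
  basis; it shows that the description \<open>gradient\<close> denotes.\<close>

lemma differentiable_imp_GDERIV_gradient:
  fixes f :: "'a::euclidean_space \<Rightarrow> real"
  assumes "f differentiable (at x)"
  shows "GDERIV f x :> gradient f x"
proof -
  from assms obtain L where L: "(f has_derivative L) (at x)"
    unfolding differentiable_def by blast
  then interpret bounded_linear L by (rule has_derivative_bounded_linear)
  have "L h = h \<bullet> (\<Sum>b\<in>Basis. L b *\<^sub>R b)" for h
  proof -
    have "L h = L (\<Sum>b\<in>Basis. (h \<bullet> b) *\<^sub>R b)" by (simp add: euclidean_representation)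
    also have "\<dots> = h \<bullet> (\<Sum>b\<in>Basis. L b *\<^sub>R b)"
      by (simp add: sum scaleR inner_sum_right mult.commute)
    finally show ?thesis .
  qed
  then have "L = (\<lambda>h. h \<bullet> (\<Sum>b\<in>Basis. L b *\<^sub>R b))" by blast
  with L have "GDERIV f x :> (\<Sum>b\<in>Basis. L b *\<^sub>R b)" unfolding gderiv_def by metis
  with gradient_eqI show ?thesis by metis
qed

text \<open>The curve \<open>exp s *\<^sub>R x\<close> has velocity equal to its position, so the
  chain rule gives the radial expression of the hypothesis \<open>ineq\<close>.\<close>

lemma DERIV_exp_dilation:
  fixes f :: "'a::euclidean_space \<Rightarrow> real"
  assumes "f differentiable (at (exp t *\<^sub>R x))"
  shows "((\<lambda>s. f (exp s *\<^sub>R x)) has_real_derivative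
    (exp t *\<^sub>R x) \<bullet> gradient f (exp t *\<^sub>R x)) (at t)"
proof -
  have f: "(f has_derivative (\<lambda>h. h \<bullet> gradient f (exp t *\<^sub>R x))) (at (exp t *\<^sub>R x))"
    using differentiable_imp_GDERIV_gradient[OF assms] unfolding gderiv_def .
  have e: "((\<lambda>s. exp s *\<^sub>R x) has_derivative (\<lambda>h. (h * exp t) *\<^sub>R x)) (at t)"
    by (auto intro!: derivative_eq_intros)
  have "((\<lambda>s. f (exp s *\<^sub>R x)) has_derivative
      (\<lambda>h. ((h * exp t) *\<^sub>R x) \<bullet> gradient f (exp t *\<^sub>R x))) (at t)"
    using has_derivative_compose[OF e f] .
  then show ?thesis
    unfolding has_field_derivative_def
    by (rule has_derivative_eq_rhs) (simp add: fun_eq_iff ac_simps)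
qed

theorem proposition4p3:
  fixes V :: "(real ^ 2) \<times> real \<Rightarrow> real"
    and c\<^sub>2 :: real
    and \<psi>\<^sub>1 \<psi>\<^sub>2 :: "real \<Rightarrow> real"
  assumes C1: "C1_on V ((UNIV - {0}) \<times> UNIV)"
    and c2: "c\<^sub>2 > 0"
    and zero: "\<And>r z. r \<noteq> 0 \<Longrightarrow> z \<le> 0 \<Longrightarrow> V (r, z) = 0"
    and grad: "\<And>r z. r \<noteq> 0 \<Longrightarrow> norm (gradient V (r, z)) \<le> norm r"
    and ineq: "\<And>r z. r \<noteq> 0 \<Longrightarrow>
      r \<bullet> gradient (\<lambda>s. V (s, z)) r \<ge> c\<^sub>2 * (deriv (\<lambda>t. V (r, t)) z)\<^sup>2"
    and prod: "\<And>r z. r \<noteq> 0 \<Longrightarrow> V (r, z) = \<psi>\<^sub>1 (norm r) * \<psi>\<^sub>2 z"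
  shows "\<forall>r z. r \<noteq> 0 \<longrightarrow> V (r, z) = 0"
proof (intro allI impI, rule ccontr)
  fix r0 :: "real ^ 2" and z0 :: real
  assume r0: "r0 \<noteq> 0" and V0: "V (r0, z0) \<noteq> 0"
  have diff: "V differentiable (at (r, z))" if "r \<noteq> 0" for r z
    using C1 that unfolding C1_on_def by auto
  \<comment> \<open>The hypothesis \<open>ineq\<close> concerns slices of \<open>V\<close>; their
    differentiability makes its \<open>gradient\<close> and \<open>deriv\<close> genuine
    derivatives.\<close>
  have diff_r: "(\<lambda>s. V (s, z)) differentiable (at r)" if "r \<noteq> 0" for r z
    by (rule differentiable_compose[where g = "\<lambda>s. (s, z)", OF diff[OF that]])
      (auto simp: differentiable_def intro!: exI derivative_intros)
  have diff_z: "(\<lambda>t. V (r, t)) differentiable (at z)" if "r \<noteq> 0" for r z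
    by (rule differentiable_compose[where g = "\<lambda>t. (r, t)", OF diff[OF that]])
      (auto simp: differentiable_def intro!: exI derivative_intros)
  define w where "w = deriv (\<lambda>t. V (r0, t))"
  have w: "((\<lambda>t. V (r0, t)) has_real_derivative w z) (at z)" for z
    using diff_z[OF r0, of z] unfolding w_def
    by (simp add: DERIV_deriv_iff_real_differentiable)
  \<comment> \<open>Otherwise \<open>V (r0, t)\<close> would be constant in \<open>t\<close>, hence
    equal to its value 0 at height 0.\<close>
  obtain z where wz: "w z \<noteq> 0"
  proof (rule ccontr)
    assume "\<not> thesis"
    with that w have "\<forall>z. ((\<lambda>t. V (r0, t)) has_real_derivative 0) (at z)" by metis
    then have "V (r0, z0) = V (r0, 0)" by (rule DERIV_isconst_all)
    with V0 zero[OF r0, of 0] show False by simp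
  qed
  have \<psi>1: "\<psi>\<^sub>1 (norm r0) \<noteq> 0" using V0 prod[OF r0, of z0] by auto
  \<comment> \<open>All vertical slices are multiples of the one at \<open>r0\<close>, so
    \<open>\<psi>\<^sub>2\<close> itself is never differentiated.\<close>
  have deriv_z: "deriv (\<lambda>t. V (r, t)) z = \<psi>\<^sub>1 (norm r) / \<psi>\<^sub>1 (norm r0) * w z"
    if "r \<noteq> 0" for r
  proof (rule DERIV_imp_deriv)
    have "(\<lambda>t. V (r, t)) = (\<lambda>t. \<psi>\<^sub>1 (norm r) / \<psi>\<^sub>1 (norm r0) * V (r0, t))"
      using \<psi>1 by (simp add: fun_eq_iff prod[OF that] prod[OF r0])
    then show "((\<lambda>t. V (r, t)) has_real_derivative
        \<psi>\<^sub>1 (norm r) / \<psi>\<^sub>1 (norm r0) * w z) (at z)"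
      by (simp only: DERIV_cmult[OF w])
  qed
  define u where "u t = V (exp t *\<^sub>R r0, z)" for t
  define u' where "u' t = (exp t *\<^sub>R r0) \<bullet> gradient (\<lambda>s. V (s, z)) (exp t *\<^sub>R r0)" for t
  have u: "(u has_real_derivative u' t) (at t)" for t
    unfolding u_def[abs_def] u'_def by (rule DERIV_exp_dilation) (rule diff_r, simp add: r0)
  have u'_ge: "c\<^sub>2 * (\<psi>\<^sub>1 (norm (exp t *\<^sub>R r0)) / \<psi>\<^sub>1 (norm r0) * w z)\<^sup>2 \<le> u' t" for t
    using ineq[of "exp t *\<^sub>R r0" z] deriv_z[of "exp t *\<^sub>R r0"] r0 unfolding u'_def by simp
  have u_prod: "u t = \<psi>\<^sub>1 (norm (exp t *\<^sub>R r0)) * \<psi>\<^sub>2 z" for t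
    unfolding u_def by (rule prod) (simp add: r0)
  \<comment> \<open>If it were 0, then \<open>u\<close> and its derivative would vanish, while
    \<open>u'_ge\<close> at time 0 gives the positive bound
    \<open>c\<^sub>2 * (w z)\<^sup>2\<close>.\<close>
  have \<psi>2: "\<psi>\<^sub>2 z \<noteq> 0"
  proof
    assume "\<psi>\<^sub>2 z = 0"
    then have "u = (\<lambda>_. 0)" using u_prod by auto
    with u[of 0] have "u' 0 = 0" by (metis DERIV_const DERIV_unique)
    with u'_ge[of 0] \<psi>1 have "c\<^sub>2 * (w z)\<^sup>2 \<le> 0" by simp
    with c2 wz show False by (simp add: mult_le_0_iff)
  qed
  \<comment> \<open>Chosen so that \<open>k * (u t)\<^sup>2\<close> is exactly the lower bound in
    \<open>u'_ge\<close>: the factor \<open>\<psi>\<^sub>2 z\<close> cancels.\<close>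
  define k where "k = c\<^sub>2 * (w z / (\<psi>\<^sub>1 (norm r0) * \<psi>\<^sub>2 z))\<^sup>2"
  have "u 0 = 0"
  proof (rule riccati_inequality_global_zero[OF u])
    show "k > 0" unfolding k_def using c2 wz \<psi>1 \<psi>2 by simp
    show "k * (u t)\<^sup>2 \<le> u' t" for t
    proof -
      have "k * (u t)\<^sup>2 = c\<^sub>2 * (\<psi>\<^sub>1 (norm (exp t *\<^sub>R r0)) / \<psi>\<^sub>1 (norm r0) * w z)\<^sup>2"
        unfolding k_def u_prod using \<psi>2 by (simp add: power_mult_distrib power_divide)
      with u'_ge show ?thesis by simp
    qed
  qed
  with u_prod[of 0] \<psi>1 \<psi>2 show False by simp
qed

end
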